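(* Let $n,z,\mathcal{K}\ge1$ be integers and let $A$ be an ABEL-Spline function on $[0,1]^n$ with partition number $z$, $\mathcal{K}$ pairs of exponential terms and trainable parameters $\theta\in\Theta$. Then, for every value of $\theta$ and any $x,y\in[0,1]^n$, $$\min_{i}|x_i-y_i|>z^{-1}\implies\nabla_\theta A(x)\cdot\nabla_\theta A(y)=0.$$
   Context: Cubic spline activation $S:\mathbb{R}\to\mathbb{R}$: $S(t)=\frac16t^3$ for $0\le t<1$; $S(t)=\frac16[-3(t-1)^3+3(t-1)^2+3(t-1)+1]$ for $1\le t<2$; $S(t)=\frac16[3(t-2)^3-6(t-2)^2+4]$ for $2\le t<3$; $S(t)=\frac16(4-t)^3$ for $3\le t<4$; $S(t)=0$ otherwise. A $z$-Spline ANN on $[0,1]^n$ with real trainable parameters $(\theta_{i,j})_{1\le i\le 4z+3,\,1\le j\le n}$ is $f(x)=\sum_{j=1}^n\sum_{i=1}^{4z+3}\theta_{i,j}\,S(4z\,x_j+4-i)$. An ABEL-Spline with partition number $z$ and $\mathcal{K}$ pairs of exponential terms is $$A(x)=F(x)+\sum_{k=1}^{\mathcal{K}}\frac1{k^2}\big(\exp(G_k(x))-\exp(H_k(x))\big),$$ where $F,G_1,\dots,G_{\mathcal K},H_1,\dots,H_{\mathcal K}$ are $z$-Spline ANNs on $[0,1]^n$, each with its own independent parameters. The trainable parameter vector $\theta$ of $A$ consists of all the parameters of these $2\mathcal{K}+1$ functions ($\Theta=\mathbb{R}^{n(4z+3)(2\mathcal K+1)}$). $\nabla_\theta A(x)$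 is the gradient with respect to $\theta$ at input $x$; both gradients are evaluated at the same $\theta$. *)

theory Defs
  imports "HOL-Analysis.Analysis"
begin

definition cubic_spline :: "real \<Rightarrow> real" where
  "cubic_spline t =
    (if 0 \<le> t \<and> t < 1 then 1/6 * t^3
     else if 1 \<le> t \<and> t < 2 then 1/6 * (- 3 * (t - 1)^3 + 3 * (t - 1)^2 + 3 * (t - 1) + 1)
     else if 2 \<le> t \<and> t < 3 then 1/6 * (3 * (t - 2)^3 - 6 * (t - 2)^2 + 4)
     else if 3 \<le> t \<and> t < 4 then 1/6 * (4 - t)^3
     else 0)"

definition spline_ann :: "nat \<Rightarrow> (nat \<Rightarrow> 'n \<Rightarrow> real) \<Rightarrow> real ^ 'n::finite \<Rightarrow> real" where
  "spline_ann z w x =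
    (\<Sum>j\<in>UNIV. \<Sum>i = 1..4*z+3. w i j * cubic_spline (4 * real z * x $ j + 4 - real i))"

text \<open>The names of the \<open>2 K + 1\<close> constituents \<open>F\<close>, \<open>G\<^sub>k\<close>, \<open>H\<^sub>k\<close>. A single scalar
  parameter is named by a triple: constituent, basis function \<open>i\<close>, coordinate \<open>j\<close>.\<close>

datatype part = PartF | PartG nat | PartH nat

definition param_index :: "nat \<Rightarrow> nat \<Rightarrow> (part \<times> nat \<times> 'n::finite) set" where
  "param_index z K =
    ({PartF} \<union> PartG ` {1..K} \<union> PartH ` {1..K}) \<times> {1..4*z+3} \<times> UNIV"

definition abel_spline ::
    "nat \<Rightarrow> nat \<Rightarrow> (part \<times> nat \<times> 'n \<Rightarrow> real) \<Rightarrow> real ^ 'n::finite \<Rightarrow> real" where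
  "abel_spline z K w x =
    spline_ann z (\<lambda>i j. w (PartF, i, j)) x +
    (\<Sum>k = 1..K. 1 / (real k)^2 *
       (exp (spline_ann z (\<lambda>i j. w (PartG k, i, j)) x) -
        exp (spline_ann z (\<lambda>i j. w (PartH k, i, j)) x)))"

definition gradient :: "('a::real_inner \<Rightarrow> real) \<Rightarrow> 'a \<Rightarrow> 'a" where
  "gradient f \<theta> = (THE D. GDERIV f \<theta> :> D)"

lemma gradient_eqI:
  assumes "GDERIV f \<theta> :> D"
  shows "gradient f \<theta> = D"
  unfolding gradient_def
proof (rule the_equality)
  fix E assume "GDERIV f \<theta> :> E"
  then have "(\<lambda>h. inner h E) = (\<lambda>h. inner h D)"
    using assms has_derivative_unique unfolding gderiv_def by blast
  then show "E = D"
    by (metis inner_commute vector_eq_rdot)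
qed (fact assms)

text \<open>The parameter vector lives in \<open>real ^ 'p\<close>; a map \<open>e\<close> assigns to each parameter name its
  coordinate. The ABEL-Spline is differentiable in that vector, so \<open>gradient\<close> is not a junk value
  there.\<close>

lemma abel_spline_differentiable:
  fixes \<theta> :: "real ^ 'p::finite"
  shows "(\<lambda>\<theta>. abel_spline z K (\<lambda>q. \<theta> $ e q) x) differentiable (at \<theta>)"
proof -
  have S: "(\<lambda>\<theta>::real^'p. spline_ann z (\<lambda>i j. \<theta> $ e (b, i, j)) x) differentiable (at \<theta>)" for b
    unfolding spline_ann_def
    by (intro differentiable_sum ballI finite differentiable_mult differentiable_const
        bounded_linear_imp_differentiable bounded_linear_vec_nth finite_atLeastAtMost)
  have E: "(\<lambda>\<theta>::real^'p. exp (spline_ann z (\<lambda>i j. \<theta> $ e (b, i, j)) x)) differentiable (at \<theta>)" for b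
    using S[of b] unfolding differentiable_def
    by (auto dest: has_derivative_exp)
  show ?thesis
    unfolding abel_spline_def
    by (intro differentiable_add S differentiable_sum ballI differentiable_mult
        differentiable_const differentiable_diff E finite_atLeastAtMost)
qed

lemma gderiv_gradient:
  fixes f :: "'a::euclidean_space \<Rightarrow> real"
  assumes "f differentiable (at \<theta>)"
  shows "GDERIV f \<theta> :> gradient f \<theta>"
proof -
  obtain f' where f': "(f has_derivative f') (at \<theta>)"
    using assms unfolding differentiable_def by blast
  then interpret bounded_linear f'
    by (rule has_derivative_bounded_linear)
  have "f' h = inner h (\<Sum>b\<in>Basis. f' b *\<^sub>R b)" for h
  proof -
    have "f' h = f' (\<Sum>b\<in>Basis. inner h b *\<^sub>R b)"
      by (simp add: euclidean_representation)
    also have "\<dots> = (\<Sum>b\<in>Basis. inner h b * f' b)"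
      by (simp add: sum scaleR)
    finally show ?thesis
      by (simp add: inner_sum_right mult.commute)
  qed
  then have "f' = (\<lambda>h. inner h (\<Sum>b\<in>Basis. f' b *\<^sub>R b))"
    by blast
  with f' have "GDERIV f \<theta> :> (\<Sum>b\<in>Basis. f' b *\<^sub>R b)"
    unfolding gderiv_def by simp
  then show ?thesis
    using gradient_eqI by metis
qed

end

theory Submission
  imports Defs
begin

text \<open>A parameter \<open>(c, i, j)\<close> enters the spline value at \<open>x\<close> only through the product with
  \<open>S (4 z x\<^sub>j + 4 - i)\<close>, whatever constituent \<open>c\<close> it belongs to; so where this factor vanishes, the
  corresponding partial derivative is \<open>0\<close>. Since \<open>S\<close> is supported in an interval of length \<open>4\<close>,
  the factors at \<open>x\<close> and \<open>y\<close> cannot both be nonzero once \<open>4 z \<bar>x\<^sub>j - y\<^sub>j\<bar> > 4\<close>. Hence every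
  summand of the inner product is \<open>0\<close>.\<close>

lemma cubic_spline_eq_0:
  assumes "t < 0 \<or> 4 \<le> t"
  shows "cubic_spline t = 0"
  using assms by (auto simp: cubic_spline_def)

lemma spline_ann_cong:
  assumes "\<And>i j. i \<in> {1..4*z+3} \<Longrightarrow> cubic_spline (4 * real z * x $ j + 4 - real i) \<noteq> 0 \<Longrightarrow> v i j = w i j"
  shows "spline_ann z v x = spline_ann z w x"
  unfolding spline_ann_def using assms by (intro sum.cong refl) (metis mult_cancel_right)

text \<open>Turns a vanishing basis factor into independence of the value from that parameter, so
  that no derivative of the exponential terms has to be computed.\<close>

lemma abel_spline_cong:
  assumes "\<And>c i j. (c, i, j) \<in> param_index z K \<Longrightarrow>
    cubic_spline (4 * real z * x $ j + 4 - real i) \<noteq> 0 \<Longrightarrow> v (c, i, j) = w (c, i, j)"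
  shows "abel_spline z K v x = abel_spline z K w x"
proof -
  have "spline_ann z (\<lambda>i j. v (c, i, j)) x = spline_ann z (\<lambda>i j. w (c, i, j)) x"
    if "c \<in> {PartF} \<union> PartG ` {1..K} \<union> PartH ` {1..K}" for c
    using that by (intro spline_ann_cong assms) (auto simp: param_index_def)
  then show ?thesis
    unfolding abel_spline_def by (intro arg_cong2[where f = "(+)"] sum.cong) auto
qed

text \<open>On the line through \<open>\<theta>\<close> in direction \<open>u\<close> the function
  is constant, so the chain rule forces the derivative \<open>t * (u \<bullet> D)\<close> to
  vanish.\<close>

lemma GDERIV_inner_eq_0:
  assumes "GDERIV f \<theta> :> D" and "\<And>t. f (\<theta> + t *\<^sub>R u) = f \<theta>"
  shows "u \<bullet> D = 0"
proof -
  have "((\<lambda>t::real. \<theta> + t *\<^sub>R u) has_derivative (\<lambda>t. t *\<^sub>R u)) (at 0)"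
    by (auto intro!: derivative_eq_intros)
  moreover have "(f has_derivative (\<lambda>h. h \<bullet> D)) (at (\<theta> + 0 *\<^sub>R u))"
    using assms(1) by (simp add: gderiv_def)
  ultimately have "((\<lambda>t. f (\<theta> + t *\<^sub>R u)) has_derivative (\<lambda>t. (t *\<^sub>R u) \<bullet> D)) (at 0)"
    by (rule has_derivative_compose)
  then have "((\<lambda>t::real. f \<theta>) has_derivative (\<lambda>t. (t *\<^sub>R u) \<bullet> D)) (at 0)"
    by (simp only: assms(2))
  then have "(\<lambda>t. (t *\<^sub>R u) \<bullet> D) = (\<lambda>t. 0)"
    using has_derivative_const by (rule has_derivative_unique)
  from fun_cong[OF this, of 1] show ?thesis by simp
qed

text \<open>Moving \<open>\<theta>\<close> along the axis of this coordinate leaves the value fixed,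
  and differentiability makes \<open>gradient\<close> the true derivative.\<close>

lemma gradient_abel_spline_nth_eq_0:
  fixes \<theta> :: "real ^ 'p::finite"
  assumes "inj_on e (param_index z K)" and "(c, i, j) \<in> param_index z K"
    and zero: "cubic_spline (4 * real z * x $ j + 4 - real i) = 0"
  shows "gradient (\<lambda>\<theta>. abel_spline z K (\<lambda>q. \<theta> $ e q) x) \<theta> $ e (c, i, j) = 0"
proof -
  have "abel_spline z K (\<lambda>q. (\<theta> + t *\<^sub>R axis (e (c, i, j)) 1) $ e q) x
      = abel_spline z K (\<lambda>q. \<theta> $ e q) x" for t
  proof (rule abel_spline_cong)
    fix c' i' j'
    assume "(c', i', j') \<in> param_index z K"
      and "cubic_spline (4 * real z * x $ j' + 4 - real i') \<noteq> 0"
    \<comment> \<open>The triples differ because the factor vanishes for one and not for the other;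
      injectivity of \<open>e\<close> keeps their coordinates apart.\<close>
    then have "e (c', i', j') \<noteq> e (c, i, j)"
      using assms by (auto dest: inj_onD)
    then show "(\<theta> + t *\<^sub>R axis (e (c, i, j)) 1) $ e (c', i', j') = \<theta> $ e (c', i', j')"
      by (simp add: axis_def)
  qed
  from GDERIV_inner_eq_0[OF gderiv_gradient[OF abel_spline_differentiable] this]
  show ?thesis by (simp add: inner_axis')
qed

theorem proposition52:
  fixes z K :: nat
    and e :: "part \<times> nat \<times> 'n::finite \<Rightarrow> 'p::finite"
    and \<theta> :: "real ^ 'p"
    and x y :: "real ^ 'n"
  assumes "z \<ge> 1" and "K \<ge> 1"
    and "bij_betw e (param_index z K) (UNIV :: 'p set)"
    and "x \<in> cbox 0 1" and "y \<in> cbox 0 1"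
    and "Min (range (\<lambda>i. \<bar>x $ i - y $ i\<bar>)) > 1 / real z"
  shows "gradient (\<lambda>\<theta>. abel_spline z K (\<lambda>q. \<theta> $ e q) x) \<theta>
       \<bullet> gradient (\<lambda>\<theta>. abel_spline z K (\<lambda>q. \<theta> $ e q) y) \<theta> = 0"
proof -
  let ?g = "\<lambda>x. gradient (\<lambda>\<theta>. abel_spline z K (\<lambda>q. \<theta> $ e q) x) \<theta>"
  have inj: "inj_on e (param_index z K)" and surj: "e ` param_index z K = UNIV"
    using assms(3) by (auto simp: bij_betw_def)
  have "?g x $ p = 0 \<or> ?g y $ p = 0" for p
  proof -
    \<comment> \<open>Surjectivity of \<open>e\<close> gives each coordinate a parameter name, whose
      \<open>j\<close> selects the input coordinate to compare.\<close>
    obtain c i j where q: "(c, i, j) \<in> param_index z K" and p: "p = e (c, i, j)"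
      using surj by (metis UNIV_I imageE prod_cases3)
    let ?s = "\<lambda>x::real^'n. 4 * real z * x $ j + 4 - real i"
    have "1 / real z < \<bar>x $ j - y $ j\<bar>"
      using assms(6) by simp
    then have "4 < 4 * real z * \<bar>x $ j - y $ j\<bar>"
      using assms(1) by (simp add: field_simps)
    also have "\<dots> = \<bar>?s x - ?s y\<bar>"
      by (simp add: abs_mult flip: right_diff_distrib)
    \<comment> \<open>Two nonzero values would put both arguments between \<open>0\<close> and
      \<open>4\<close>, hence less than \<open>4\<close> apart.\<close>
    finally have "cubic_spline (?s x) = 0 \<or> cubic_spline (?s y) = 0"
      using cubic_spline_eq_0[of "?s x"] cubic_spline_eq_0[of "?s y"] by linarith
    then show ?thesis
      unfolding p using gradient_abel_spline_nth_eq_0[OF inj q] by blast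
  qed
  then show ?thesis
    by (auto simp: inner_vec_def intro!: sum.neutral)
qed

end
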